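(* Let $\Phi(u,v)=1+\sum_{n\ge d\ge 1} T(2n,d)\,u^n v^d$. Then \begin{equation*} \Phi(u,v)= \cos\!\big(\pi\sqrt{(1-v)u}/2\big)\, \sec\!\big(\pi\sqrt{u}/2\big), \end{equation*} where the right-hand side is understood as the product of the power series $\cos(\pi\sqrt{(1-v)u}/2)=\sum_{j\ge0}\frac{(-1)^j\pi^{2j}(1-v)^ju^j}{4^j(2j)!}$ and $\sec(\pi\sqrt u/2)$ expanded as a power series in $u$.
   Context: For positive integers $s_1,\dots,s_d$ (with $s_1\ge2$), the multiple $t$-value is $t(s_1,\dots,s_d)=\sum_{n_1>\cdots>n_d\ge 1}\prod_{i=1}^d (2n_i-1)^{-s_i}$. For positive integers $d\le n$ define $T(2n,d)=\sum_{j_1+\cdots+j_d=n,\ j_1,\dots,j_d\ge 1} t(2j_1,\dots,2j_d)$. *)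

theory Defs
  imports "HOL-Analysis.Analysis" "HOL-Computational_Algebra.Formal_Power_Series"
begin

text \<open>Index tuples are lists: \<open>[n\<^sub>1, \<dots>, n\<^sub>d]\<close> with \<open>n\<^sub>1 > \<dots> > n\<^sub>d \<ge> 1\<close>.\<close>

definition decreasing_tuples :: "nat \<Rightarrow> nat list set" where
  "decreasing_tuples d = {ns. length ns = d \<and> sorted_wrt (>) ns \<and> (\<forall>n\<in>set ns. n \<ge> 1)}"

text \<open>Meaningful only for positive exponents with \<open>s\<^sub>1 \<ge> 2\<close>, where the series converges
  (absolutely, all terms being positive); \<open>infsum\<close> of a non-summable family is 0.\<close>

definition mtv :: "nat list \<Rightarrow> real" where
  "mtv ss = (\<Sum>\<^sub>\<infinity>ns\<in>decreasing_tuples (length ss).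
               \<Prod>i<length ss. 1 / (2 * real (ns ! i) - 1) ^ (ss ! i))"

definition compositions :: "nat \<Rightarrow> nat \<Rightarrow> nat list set" where
  "compositions n d = {js. length js = d \<and> (\<forall>j\<in>set js. j \<ge> 1) \<and> sum_list js = n}"

text \<open>\<open>T_even n d\<close> is the quantity \<open>T(2n, d)\<close>: the weight is \<open>2n\<close>, not \<open>n\<close>.\<close>

definition T_even :: "nat \<Rightarrow> nat \<Rightarrow> real" where
  "T_even n d = (\<Sum>js\<in>compositions n d. mtv (map (\<lambda>j. 2 * j) js))"

text \<open>Formal power series in \<open>u, v\<close> are elements of \<open>\<real>[[v]][[u]]\<close>: the outer \<open>fps\<close> variable is
  \<open>u\<close> and the inner one is \<open>v\<close>.\<close>

definition Phi :: "real fps fps" where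
  "Phi = 1 + Abs_fps (\<lambda>n. Abs_fps (\<lambda>d. if n \<ge> d \<and> d \<ge> 1 then T_even n d else 0))"

text \<open>\<open>cos_coeff_half j\<close> is the coefficient of \<open>x\<^sup>j\<close> in \<open>cos (\<pi> \<surd>x / 2)\<close>.\<close>

definition cos_coeff_half :: "nat \<Rightarrow> real" where
  "cos_coeff_half j = (-1) ^ j * pi ^ (2 * j) / (4 ^ j * fact (2 * j))"

lemma cos_coeff_half_sums:
  assumes "x \<ge> 0"
  shows "(\<lambda>j. cos_coeff_half j * x ^ j) sums cos (pi * sqrt x / 2)"
proof -
  have "(\<lambda>j. (-1) ^ j / fact (2 * j) * (pi * sqrt x / 2) ^ (2 * j)) sums cos (pi * sqrt x / 2)"
    using cos_paired by simp
  also have "(\<lambda>j. (-1) ^ j / fact (2 * j) * (pi * sqrt x / 2) ^ (2 * j))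
           = (\<lambda>j. cos_coeff_half j * x ^ j)"
    using assms
    by (simp add: cos_coeff_half_def power_mult power_mult_distrib power_divide fun_eq_iff mult.assoc
        mult.commute [of "4 ^ _" "fact _"])
  finally show ?thesis .
qed

text \<open>\<open>cos (\<pi> \<surd>((1 - v) u) / 2)\<close>; the inner \<open>fps_X\<close> is \<open>v\<close>.\<close>

definition cos_series :: "real fps fps" where
  "cos_series = Abs_fps (\<lambda>j. fps_const (cos_coeff_half j) * (1 - fps_X) ^ j)"

text \<open>\<open>sec (\<pi> \<surd>u / 2)\<close> as a series in \<open>u\<close> alone: the reciprocal of the series of
  \<open>cos (\<pi> \<surd>u / 2)\<close>, whose constant coefficient is 1.\<close>

definition sec_series_u :: "real fps" where
  "sec_series_u = inverse (Abs_fps cos_coeff_half)"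

lemma cos_times_sec_series_u: "Abs_fps cos_coeff_half * sec_series_u = 1"
  unfolding sec_series_u_def
  by (intro inverse_mult_eq_1') (simp add: cos_coeff_half_def)

text \<open>The same series viewed in \<open>\<real>[[v]][[u]]\<close>.\<close>

definition sec_series :: "real fps fps" where
  "sec_series = Abs_fps (\<lambda>k. fps_const (fps_nth sec_series_u k))"

end

theory Submission
  imports Defs "HOL-Complex_Analysis.Cauchy_Integral_Formula"
begin

text \<open>
  Put \<open>a\<^sub>n = 1 / (2 n - 1)\<^sup>2\<close>. Summing over compositions turns \<open>\<Phi>\<close> into the product of the factors
  \<open>1 + v (a\<^sub>n u + a\<^sub>n\<^sup>2 u\<^sup>2 + \<dots>) = (1 - (1 - v) a\<^sub>n u) / (1 - a\<^sub>n u)\<close>. Restricting all indices to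
  \<open>n \<le> N\<close> makes this an exact identity of formal power series, and every coefficient converges
  as \<open>N \<rightarrow> \<infinity>\<close>. The product \<open>\<Prod> (1 - a\<^sub>n x)\<close> is \<open>cos (\<pi> \<surd>x / 2)\<close>; Tannery's theorem and uniqueness
  of power series upgrade this analytic identity to convergence of the individual coefficients.
\<close>

unbundle no vec_syntax
unbundle fps_syntax

subsection \<open>Truncated multiple t-values\<close>

definition decreasing_tuples_upto :: "nat \<Rightarrow> nat \<Rightarrow> nat list set" where
  "decreasing_tuples_upto N d = {ns \<in> decreasing_tuples d. set ns \<subseteq> {..N}}"

definition mtv_term :: "nat list \<Rightarrow> nat list \<Rightarrow> real" where
  "mtv_term ss ns = (\<Prod>i<length ss. 1 / (2 * real (ns ! i) - 1) ^ (ss ! i))"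

definition mtv_upto :: "nat \<Rightarrow> nat list \<Rightarrow> real" where
  "mtv_upto N ss = sum (mtv_term ss) (decreasing_tuples_upto N (length ss))"

lemma mtv_eq_infsum_mtv_term: "mtv ss = infsum (mtv_term ss) (decreasing_tuples (length ss))"
  by (simp add: mtv_def mtv_term_def [abs_def])

lemma finite_decreasing_tuples_upto: "finite (decreasing_tuples_upto N d)"
proof (rule finite_subset)
  show "decreasing_tuples_upto N d \<subseteq> {ns. set ns \<subseteq> {..N} \<and> length ns = d}"
    by (auto simp: decreasing_tuples_upto_def decreasing_tuples_def)
  show "finite {ns. set ns \<subseteq> {..N} \<and> length ns = d}"
    by (rule finite_lists_length_eq) simp
qed

lemma decreasing_tuples_upto_0: "decreasing_tuples_upto N 0 = {[]}"
  by (auto simp: decreasing_tuples_upto_def decreasing_tuples_def)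

lemma decreasing_tuples_upto_0_Suc: "decreasing_tuples_upto 0 (Suc d) = {}"
  by (auto simp: decreasing_tuples_upto_def decreasing_tuples_def length_Suc_conv)

text \<open>Only the head of a decreasing tuple can equal \<open>Suc N\<close>; once it is removed,
  the tail is bounded by \<open>N\<close>.\<close>

lemma decreasing_tuples_upto_Suc_Suc:
  "decreasing_tuples_upto (Suc N) (Suc d) =
     decreasing_tuples_upto N (Suc d) \<union> (#) (Suc N) ` decreasing_tuples_upto N d"
proof (intro set_eqI iffI)
  fix ns
  assume ns: "ns \<in> decreasing_tuples_upto (Suc N) (Suc d)"
  then obtain m ms where eq: "ns = m # ms" "length ms = d"
    by (auto simp: decreasing_tuples_upto_def decreasing_tuples_def length_Suc_conv)
  from ns have props: "m \<le> Suc N" "m \<ge> 1" "\<forall>x\<in>set ms. x < m \<and> x \<ge> 1" "sorted_wrt (>) ms"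
    by (auto simp: eq decreasing_tuples_upto_def decreasing_tuples_def)
  show "ns \<in> decreasing_tuples_upto N (Suc d) \<union> (#) (Suc N) ` decreasing_tuples_upto N d"
  proof (cases "m = Suc N")
    case True
    with props eq have "ms \<in> decreasing_tuples_upto N d"
      by (auto simp: decreasing_tuples_upto_def decreasing_tuples_def less_Suc_eq_le)
    with True eq show ?thesis by blast
  next
    case False
    with props eq have "ns \<in> decreasing_tuples_upto N (Suc d)"
      by (auto simp: decreasing_tuples_upto_def decreasing_tuples_def dest: bspec)
    then show ?thesis by blast
  qed
next
  fix ns
  assume "ns \<in> decreasing_tuples_upto N (Suc d) \<union> (#) (Suc N) ` decreasing_tuples_upto N d"
  then show "ns \<in> decreasing_tuples_upto (Suc N) (Suc d)"
    unfolding decreasing_tuples_upto_def decreasing_tuples_def by fastforce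
qed

lemma mtv_term_Cons: "mtv_term (s # ss) (n # ns) = 1 / (2 * real n - 1) ^ s * mtv_term ss ns"
  by (simp add: mtv_term_def prod.lessThan_Suc_shift del: prod.lessThan_Suc)

lemma mtv_upto_Nil: "mtv_upto N [] = 1"
  by (simp add: mtv_upto_def mtv_term_def decreasing_tuples_upto_0)

lemma mtv_upto_0_Cons: "mtv_upto 0 (s # ss) = 0"
  by (simp add: mtv_upto_def decreasing_tuples_upto_0_Suc)

text \<open>The new tuples are those with head \<open>Suc N\<close>, whose odd number is
  \<open>2 * N + 1\<close>. With the two base cases above, this recursion replaces the defining sum
  in all later inductions on \<open>N\<close>.\<close>

lemma mtv_upto_Suc_Cons:
  "mtv_upto (Suc N) (s # ss) =
     mtv_upto N (s # ss) + 1 / (2 * real N + 1) ^ s * mtv_upto N ss"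
proof -
  have "mtv_upto (Suc N) (s # ss) = mtv_upto N (s # ss) +
      sum (mtv_term (s # ss)) ((#) (Suc N) ` decreasing_tuples_upto N (length ss))"
    unfolding mtv_upto_def length_Cons decreasing_tuples_upto_Suc_Suc
    by (rule sum.union_disjoint)
       (auto simp: finite_decreasing_tuples_upto, auto simp: decreasing_tuples_upto_def)
  also have "sum (mtv_term (s # ss)) ((#) (Suc N) ` decreasing_tuples_upto N (length ss)) =
      (\<Sum>ns\<in>decreasing_tuples_upto N (length ss). 1 / (2 * real N + 1) ^ s * mtv_term ss ns)"
    by (subst sum.reindex) (auto simp: mtv_term_Cons add_ac)
  finally show ?thesis
    by (simp add: mtv_upto_def sum_distrib_left)
qed

section \<open>Bounds uniform in the truncation\<close>

lemma mtv_upto_nonneg: "mtv_upto N ss \<ge> 0"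
  by (induction N arbitrary: ss; case_tac ss)
     (auto simp: mtv_upto_Nil mtv_upto_0_Cons mtv_upto_Suc_Cons)

text \<open>A constant bound would not survive the induction. A bound growing with \<open>N\<close>
  does: its base starts at 1, and its increments dominate
  \<open>1 / (2 * N + 1) ^ 2\<close>.\<close>

lemma mtv_upto_le_aux:
  assumes "\<forall>s\<in>set ss. s \<ge> 2"
  shows "mtv_upto N ss \<le> (3 - 2 / (real N + 1)) ^ length ss"
  using assms
proof (induction N arbitrary: ss)
  case 0
  then show ?case by (cases ss) (auto simp: mtv_upto_Nil mtv_upto_0_Cons)
next
  case (Suc N)
  show ?case
  proof (cases ss)
    case Nil
    then show ?thesis by (simp add: mtv_upto_Nil)
  next
    case (Cons s ts)
    define B where "B = (\<lambda>N. 3 - 2 / (real N + 1))"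
    have IH: "mtv_upto N us \<le> B N ^ length us" if "\<forall>s\<in>set us. s \<ge> 2" for us
      using Suc.IH [OF that] by (simp add: B_def)
    have B: "B N \<ge> 1" by (simp add: B_def field_simps)
    have "1 / (2 * real N + 1) ^ s \<le> 1 / (2 * real N + 1) ^ 2"
      using Suc.prems Cons by (intro divide_left_mono power_increasing) auto
    also have "1 / (2 * real N + 1) ^ 2 = 2 / (2 * (2 * real N + 1) ^ 2)"
      by simp
    \<comment> \<open>This is \<open>(N + 1) * (N + 2) \<le> 2 * (2 * N + 1) ^ 2\<close>, with
      equality at \<open>N = 0\<close>; hence the numerator 2 in \<open>B\<close>.\<close>
    also have "\<dots> \<le> 2 / ((real N + 1) * (real N + 2))"
      by (rule divide_left_mono) (auto simp: algebra_simps power2_eq_square add_pos_nonneg)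
    also have "\<dots> = B (Suc N) - B N"
      by (simp add: B_def field_simps)
    finally have step: "1 / (2 * real N + 1) ^ s \<le> B (Suc N) - B N" .
    then have mono: "B N \<le> B (Suc N)"
      by (smt (verit) divide_nonneg_nonneg of_nat_0_le_iff zero_le_power)
    have "mtv_upto (Suc N) ss = mtv_upto N ss + 1 / (2 * real N + 1) ^ s * mtv_upto N ts"
      by (simp add: Cons mtv_upto_Suc_Cons)
    also have "\<dots> \<le> B N ^ length ss + (B (Suc N) - B N) * B N ^ length ts"
      using Suc.prems Cons step mono by (intro add_mono mult_mono mtv_upto_nonneg IH) auto
    also have "\<dots> = B (Suc N) * B N ^ length ts"
      by (simp add: Cons algebra_simps)
    also have "\<dots> \<le> B (Suc N) * B (Suc N) ^ length ts"
      using B mono by (intro mult_left_mono power_mono) auto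
    finally show ?thesis by (simp add: Cons B_def)
  qed
qed

lemma mtv_upto_le:
  assumes "\<forall>s\<in>set ss. s \<ge> 2"
  shows "mtv_upto N ss \<le> 3 ^ length ss"
proof -
  have "mtv_upto N ss \<le> (3 - 2 / (real N + 1)) ^ length ss"
    by (rule mtv_upto_le_aux [OF assms])
  also have "\<dots> \<le> 3 ^ length ss"
    by (rule power_mono) (auto simp: field_simps)
  finally show ?thesis .
qed

section \<open>Convergence of the truncated values\<close>

lemma finite_subset_decreasing_tuples_upto:
  assumes "finite F" "F \<subseteq> decreasing_tuples d"
  obtains M where "\<And>N. N \<ge> M \<Longrightarrow> F \<subseteq> decreasing_tuples_upto N d"
proof -
  have "finite (\<Union>(set ` F))"
    using assms by auto
  then obtain M where "\<Union>(set ` F) \<subseteq> {..M}"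
    using finite_nat_iff_bounded_le by blast
  with assms have "F \<subseteq> decreasing_tuples_upto N d" if "N \<ge> M" for N
    using that by (fastforce simp: decreasing_tuples_upto_def)
  with that show ?thesis by blast
qed

lemma mtv_term_nonneg: "ns \<in> decreasing_tuples (length ss) \<Longrightarrow> mtv_term ss ns \<ge> 0"
  unfolding mtv_term_def decreasing_tuples_def
  by (intro prod_nonneg ballI divide_nonneg_nonneg zero_le_power)
     (auto dest!: bspec [OF _ nth_mem])

text \<open>Nonnegative terms with bounded finite sums are summable, and the unordered sum is a
  limit over finite subsets. The truncated index sets eventually contain every finite subset, so the
  limit may be taken along them.\<close>

lemma mtv_upto_tendsto:
  assumes "\<forall>s\<in>set ss. s \<ge> 2"
  shows "(\<lambda>N. mtv_upto N ss) \<longlonglongrightarrow> mtv ss"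
proof -
  let ?D = "decreasing_tuples (length ss)"
  have "mtv_term ss summable_on ?D"
  proof (rule nonneg_bdd_above_summable_on)
    show "bdd_above (sum (mtv_term ss) ` {F. F \<subseteq> ?D \<and> finite F})"
    proof (rule bdd_aboveI2)
      fix F assume "F \<in> {F. F \<subseteq> ?D \<and> finite F}"
      then obtain N where "F \<subseteq> decreasing_tuples_upto N (length ss)"
        by (metis (no_types, lifting) finite_subset_decreasing_tuples_upto mem_Collect_eq order_refl)
      then have "sum (mtv_term ss) F \<le> mtv_upto N ss"
        unfolding mtv_upto_def
        by (intro sum_mono2 finite_decreasing_tuples_upto mtv_term_nonneg)
           (auto simp: decreasing_tuples_upto_def)
      with mtv_upto_le [OF assms, of N] show "sum (mtv_term ss) F \<le> 3 ^ length ss"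
        by simp
    qed
  qed (rule mtv_term_nonneg)
  then have "(sum (mtv_term ss) \<longlongrightarrow> mtv ss) (finite_subsets_at_top ?D)"
    by (metis has_sum_def has_sum_infsum mtv_eq_infsum_mtv_term)
  moreover have "filterlim (\<lambda>N. decreasing_tuples_upto N (length ss)) (finite_subsets_at_top ?D)
      sequentially"
    unfolding filterlim_finite_subsets_at_top
  proof safe
    fix X assume "finite X" "X \<subseteq> ?D"
    then obtain M where "\<And>N. N \<ge> M \<Longrightarrow> X \<subseteq> decreasing_tuples_upto N (length ss)"
      using finite_subset_decreasing_tuples_upto by blast
    then show "\<forall>\<^sub>F N in sequentially. finite (decreasing_tuples_upto N (length ss)) \<and>
        X \<subseteq> decreasing_tuples_upto N (length ss) \<and> decreasing_tuples_upto N (length ss) \<subseteq> ?D"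
      using finite_decreasing_tuples_upto
      by (auto simp: eventually_sequentially decreasing_tuples_upto_def)
  qed
  ultimately show ?thesis
    unfolding mtv_upto_def by (rule filterlim_compose)
qed

subsection \<open>The values at repeated twos\<close>

text \<open>The coefficient of \<open>x ^ k\<close> is the \<open>k\<close>-th elementary symmetric
  polynomial in the numbers \<open>1 / (2 * n - 1) ^ 2\<close> with
  \<open>1 \<le> n \<le> N\<close>. It vanishes for \<open>k > N\<close>; the infinite series is the
  form in which limit and sum are exchanged.\<close>

lemma mtv_upto_replicate_2_sums:
  "(\<lambda>k. mtv_upto N (replicate k 2) * x ^ k) sums (\<Prod>n=1..N. 1 + x / (2 * real n - 1) ^ 2)"
proof (induction N)
  case 0
  have "mtv_upto 0 (replicate k 2) * x ^ k = (if k = 0 then 1 else 0)" for k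
    by (cases k) (auto simp: mtv_upto_Nil mtv_upto_0_Cons)
  then show ?case
    using sums_single[of 0 "\<lambda>_. 1 :: real"] by simp
next
  case (Suc N)
  let ?f = "\<lambda>k. mtv_upto N (replicate k 2) * x ^ k"
  let ?P = "\<Prod>n=1..N. 1 + x / (2 * real n - 1) ^ 2"
  let ?a = "1 / (2 * real N + 1) ^ 2"
  \<comment> \<open>The recursion needs a nonempty list, so the term \<open>k = 0\<close> is split
    off here and restored by \<open>sums_Suc\<close>.\<close>
  have "(\<lambda>k. ?f (Suc k)) sums (?P - 1)"
    using Suc by (subst sums_Suc_iff) (simp add: mtv_upto_Nil)
  moreover have "(\<lambda>k. ?a * x * ?f k) sums (?a * x * ?P)"
    by (intro sums_mult Suc)
  ultimately have "(\<lambda>k. ?f (Suc k) + ?a * x * ?f k) sums (?P - 1 + ?a * x * ?P)"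
    by (rule sums_add)
  then have "(\<lambda>k. mtv_upto (Suc N) (replicate (Suc k) 2) * x ^ Suc k) sums (?P - 1 + ?a * x * ?P)"
    by (simp add: mtv_upto_Suc_Cons algebra_simps)
  then have "(\<lambda>k. mtv_upto (Suc N) (replicate k 2) * x ^ k) sums
      (?P - 1 + ?a * x * ?P + mtv_upto (Suc N) (replicate 0 2) * x ^ 0)"
    by (rule sums_Suc)
  also have "?P - 1 + ?a * x * ?P + mtv_upto (Suc N) (replicate 0 2) * x ^ 0 =
      (\<Prod>n=1..Suc N. 1 + x / (2 * real n - 1) ^ 2)"
    by (simp add: mtv_upto_Nil algebra_simps)
  finally show ?case .
qed

text \<open>Tannery's theorem with the majorant \<open>(3 * \<bar>x\<bar>) ^ k\<close> from the
  uniform bound, whence the radius 1/3. A neighbourhood of 0 suffices for comparing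
  coefficients.\<close>

lemma mtv_replicate_2_power_series:
  assumes "\<bar>x\<bar> < 1 / 3"
  shows "summable (\<lambda>k. mtv (replicate k 2) * x ^ k)" (is ?A)
    and "(\<lambda>N. \<Prod>n=1..N. 1 + x / (2 * real n - 1) ^ 2) \<longlonglongrightarrow> (\<Sum>k. mtv (replicate k 2) * x ^ k)" (is ?B)
proof -
  have bound: "norm (mtv_upto N (replicate k 2) * x ^ k) \<le> (3 * \<bar>x\<bar>) ^ k" for N k
    using mult_right_mono [OF mtv_upto_le [of "replicate k 2" N], of "\<bar>x\<bar> ^ k"]
    by (simp add: abs_mult mtv_upto_nonneg power_abs power_mult_distrib)
  have "eventually (\<lambda>N. summable (\<lambda>k. norm (mtv_upto N (replicate k 2) * x ^ k))) sequentially \<and>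
     summable (\<lambda>k. norm (mtv (replicate k 2) * x ^ k)) \<and>
     (\<lambda>N. \<Sum>k. mtv_upto N (replicate k 2) * x ^ k) \<longlonglongrightarrow> (\<Sum>k. mtv (replicate k 2) * x ^ k)"
  proof (rule tannerys_theorem)
    show "(\<lambda>N. mtv_upto N (replicate k 2) * x ^ k) \<longlonglongrightarrow> mtv (replicate k 2) * x ^ k" for k
      by (intro tendsto_mult_right mtv_upto_tendsto) auto
    show "\<forall>\<^sub>F (k, N) in at_top \<times>\<^sub>F sequentially. norm (mtv_upto N (replicate k 2) * x ^ k) \<le> (3 * \<bar>x\<bar>) ^ k"
      using bound by (intro always_eventually) auto
    show "summable (\<lambda>k. (3 * \<bar>x\<bar>) ^ k)"
      using assms by (intro summable_geometric) auto
  qed auto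
  then show ?A ?B
    using summable_norm_cancel [of "\<lambda>k. mtv (replicate k 2) * x ^ k"]
    by (simp_all add: sums_unique [OF mtv_upto_replicate_2_sums, symmetric])
qed

text \<open>Cosine product from \<open>cos y = sin (2 y) / (2 sin y)\<close>: dividing the sine products
  leaves exactly the factors of odd index.\<close>

lemma cos_product_formula:
  fixes z :: real
  assumes "0 < z" "z < 1"
  shows "(\<lambda>N. \<Prod>n=1..N. 1 - z ^ 2 / (2 * real n - 1) ^ 2) \<longlonglongrightarrow> cos (pi * z / 2)"
proof -
  define Q where "Q = (\<lambda>n. \<Prod>k=1..n. 1 - z ^ 2 / of_nat k ^ 2)"
  define R where "R = (\<lambda>n. \<Prod>k=1..n. 1 - (z / 2) ^ 2 / of_nat k ^ 2)"
  have "Q \<longlonglongrightarrow> sin (pi * z) / (pi * z)"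
    unfolding Q_def using sin_product_formula_real' [of z] assms by simp
  then have "(Q \<circ> (\<lambda>n. 2 * n)) \<longlonglongrightarrow> sin (pi * z) / (pi * z)"
    by (rule LIMSEQ_subseq_LIMSEQ) (auto simp: strict_mono_def)
  moreover have "R \<longlonglongrightarrow> sin (pi * (z / 2)) / (pi * (z / 2))"
    unfolding R_def using assms by (intro sin_product_formula_real') auto
  \<comment> \<open>Keeps the limit of \<open>R\<close> away from 0, so that the quotient
    converges.\<close>
  moreover have sin_pos: "sin (pi * (z / 2)) > 0"
    using assms by (intro sin_gt_zero) (auto simp: field_simps)
  ultimately have lim: "(\<lambda>n. Q (2 * n) / R n) \<longlonglongrightarrow>
      (sin (pi * z) / (pi * z)) / (sin (pi * (z / 2)) / (pi * (z / 2)))"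
    using assms unfolding o_def by (intro tendsto_divide) auto
  have "sin (pi * z) = 2 * sin (pi * (z / 2)) * cos (pi * (z / 2))"
    using sin_double [of "pi * (z / 2)"] by simp
  moreover have "(2 * s * c / (pi * z)) / (s / (pi * (z / 2))) = c" if "s \<noteq> 0" for s c
    using that assms by simp
  ultimately have val: "(sin (pi * z) / (pi * z)) / (sin (pi * (z / 2)) / (pi * (z / 2))) = cos (pi * z / 2)"
    using sin_pos by (metis less_numeral_extra(3) times_divide_eq_right)
  have "R n \<noteq> 0" for n
  proof -
    have "(z / 2) ^ 2 / of_nat k ^ 2 < 1" if "k \<ge> 1" for k :: nat
    proof -
      have "(z / 2 / real k) < 1" using assms that by (simp add: field_simps)
      then have "(z / 2 / real k) ^ 2 < 1"
        using assms by (simp add: abs_square_less_1)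
      then show ?thesis by (simp add: power_divide)
    qed
    then have "1 - (z / 2) ^ 2 / of_nat k ^ 2 \<noteq> 0" if "k \<in> {1..n}" for k :: nat
      using that by fastforce
    then show ?thesis
      unfolding R_def by (subst prod_zero_iff) auto
  qed
  \<comment> \<open>The factors of \<open>Q\<close> at even indices \<open>2 * k\<close> are those
    of \<open>R\<close>, since \<open>z ^ 2 / (2 * k) ^ 2 = (z / 2) ^ 2 / k ^ 2\<close>.\<close>
  moreover have "Q (2 * n) = R n * (\<Prod>k=1..n. 1 - z ^ 2 / (2 * real k - 1) ^ 2)" for n
  proof (induction n)
    case (Suc n)
    have "Q (2 * Suc n) = Q (2 * n) * (1 - z ^ 2 / (2 * real n + 1) ^ 2) *
        (1 - z ^ 2 / (2 * real n + 2) ^ 2)"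
      by (simp add: Q_def add_ac)
    moreover have "(z / 2) ^ 2 / real (Suc n) ^ 2 = z ^ 2 / (2 * real n + 2) ^ 2"
      by (simp add: power_divide power2_eq_square algebra_simps)
    then have "R (Suc n) = R n * (1 - z ^ 2 / (2 * real n + 2) ^ 2)"
      by (simp add: R_def)
    ultimately show ?case
      by (simp add: Suc)
  qed (simp add: Q_def R_def)
  ultimately have "(\<Prod>k=1..n. 1 - z ^ 2 / (2 * real k - 1) ^ 2) = Q (2 * n) / R n" for n
    by simp
  with lim val show ?thesis by simp
qed

text \<open>By the cosine product at \<open>z = sqrt x\<close>, the power series of the two sides
  agree for small positive \<open>x\<close>. Their difference has zeros accumulating at 0, which
  forces all its coefficients to vanish.\<close>

lemma mtv_replicate_2: "(-1) ^ k * mtv (replicate k 2) = cos_coeff_half k"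
proof -
  define a where "a = (\<lambda>k. (-1) ^ k * mtv (replicate k 2) - cos_coeff_half k)"
  define f where "f = (\<lambda>x. \<Sum>k. a k * x ^ k)"
  have cos_summable: "summable (\<lambda>k. cos_coeff_half k * x ^ k)" for x :: real
  proof -
    \<comment> \<open>Convergence at a nonnegative point of larger modulus also covers negative
      \<open>x\<close>.\<close>
    have "summable (\<lambda>k. cos_coeff_half k * (\<bar>x\<bar> + 1) ^ k)"
      using cos_coeff_half_sums [of "\<bar>x\<bar> + 1"] by (auto simp: sums_iff)
    then show ?thesis
      by (rule powser_inside) simp
  qed
  have mtv_summable: "summable (\<lambda>k. (-1) ^ k * mtv (replicate k 2) * x ^ k)" if "\<bar>x\<bar> < 1 / 3" for x
    using mtv_replicate_2_power_series(1) [of "- x"] that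
    by (simp add: power_minus[of x] mult_ac)
  have sums: "(\<lambda>k. a k * (x - 0) ^ k) sums f x" if "norm (x - 0) < 1 / 3" for x
    using summable_diff [OF mtv_summable cos_summable, of x x] that
    by (simp add: f_def a_def ring_distribs summable_sums)
  have zero: "f x = 0" if "0 < x" "x < 1 / 3" for x
  proof -
    have "sqrt x < 1" using that by simp
    then have "(\<lambda>N. \<Prod>n=1..N. 1 + (- x) / (2 * real n - 1) ^ 2) \<longlonglongrightarrow> cos (pi * sqrt x / 2)"
      using cos_product_formula [of "sqrt x"] that by simp
    moreover have "(\<lambda>N. \<Prod>n=1..N. 1 + (- x) / (2 * real n - 1) ^ 2) \<longlonglongrightarrow>
        (\<Sum>k. mtv (replicate k 2) * (- x) ^ k)"
      using that by (intro mtv_replicate_2_power_series) auto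
    ultimately have "cos (pi * sqrt x / 2) = (\<Sum>k. mtv (replicate k 2) * (- x) ^ k)"
      using LIMSEQ_unique by blast
    then have "(\<Sum>k. cos_coeff_half k * x ^ k) = (\<Sum>k. (-1) ^ k * mtv (replicate k 2) * x ^ k)"
      using cos_coeff_half_sums [of x] that
      by (simp add: sums_iff power_minus [of x] mult_ac)
    then show ?thesis
      using suminf_diff [OF mtv_summable cos_summable, of x x] that
      by (simp add: f_def a_def ring_distribs)
  qed
  \<comment> \<open>Index 0 is settled directly from \<open>mtv [] = 1\<close>; the argument by
    isolated zeros needs \<open>f 0 = 0\<close> and \<open>k > 0\<close>.\<close>
  have "f 0 = a 0"
    by (simp add: f_def powser_zero)
  also have "a 0 = 0"
    using LIMSEQ_unique [OF mtv_upto_tendsto [of "[]"]]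
    by (simp add: a_def cos_coeff_half_def mtv_upto_Nil)
  finally have f0: "f 0 = 0" .
  have "a k = 0"
  proof (rule ccontr)
    assume ne: "a k \<noteq> 0"
    have "k > 0" using ne \<open>a 0 = 0\<close> by (cases k) auto
    obtain s where s: "0 < s" "\<And>z. z \<in> cball 0 s - {0} \<Longrightarrow> f z \<noteq> 0"
      using powser_0_nonzero [OF _ sums f0 ne \<open>k > 0\<close>] by (metis zero_less_divide_1_iff zero_less_numeral)
    \<comment> \<open>This point lies both in the punctured ball and in the interval
      \<open>(0, 1/3)\<close>, where \<open>f\<close> vanishes.\<close>
    have "min s (1 / 4) \<in> cball 0 s - {0}" using s by auto
    moreover have "f (min s (1 / 4)) = 0" using s by (intro zero) auto
    ultimately show False using s by blast
  qed
  then show ?thesis by (simp add: a_def)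
qed

subsection \<open>The generating function\<close>

definition T_even_upto :: "nat \<Rightarrow> nat \<Rightarrow> nat \<Rightarrow> real" where
  "T_even_upto N n d = (\<Sum>js\<in>compositions n d. mtv_upto N (map (\<lambda>j. 2 * j) js))"

definition Phi_upto :: "nat \<Rightarrow> real fps fps" where
  "Phi_upto N = Abs_fps (\<lambda>n. Abs_fps (T_even_upto N n))"

lemma compositions_0: "compositions n 0 = (if n = 0 then {[]} else {})"
  by (auto simp: compositions_def)

lemma compositions_Suc:
  "compositions n (Suc d) = (\<Union>j\<in>{1..n}. (#) j ` compositions (n - j) d)"
  by (fastforce simp: compositions_def length_Suc_conv image_iff)

lemma finite_compositions: "finite (compositions n d)"
  by (induction d arbitrary: n) (auto simp: compositions_0 compositions_Suc)

lemma compositions_eq_empty: "n < d \<Longrightarrow> compositions n d = {}"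
  by (induction d arbitrary: n) (auto simp: compositions_Suc)

lemma sum_compositions_Suc:
  "(\<Sum>js\<in>compositions n (Suc d). f js) = (\<Sum>j=1..n. \<Sum>js\<in>compositions (n - j) d. f (j # js))"
  unfolding compositions_Suc
  by (subst sum.UNION_disjoint) (auto simp: finite_compositions sum.reindex)

lemma T_even_upto_tendsto: "(\<lambda>N. T_even_upto N n d) \<longlonglongrightarrow> T_even n d"
  unfolding T_even_upto_def T_even_def
  by (intro tendsto_sum mtv_upto_tendsto) (auto simp: compositions_def)

text \<open>The summand 1 in \<open>Phi\<close> accounts for the empty composition, as
  \<open>mtv [] = 1\<close>. At all other index pairs outside \<open>n \<ge> d \<ge> 1\<close> there
  are no compositions.\<close>

lemma Phi_nth_nth: "Phi $ n $ d = T_even n d"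
proof -
  have "mtv [] = 1"
    using LIMSEQ_unique [OF mtv_upto_tendsto [of "[]"]] by (simp add: mtv_upto_Nil)
  then show ?thesis
    by (cases "n = 0"; cases "d = 0")
       (auto simp: Phi_def T_even_def compositions_0 compositions_eq_empty)
qed

section \<open>Recursion for the truncated generating function\<close>

lemma Phi_upto_0: "Phi_upto 0 = 1"
proof (intro fps_ext)
  fix n d
  show "Phi_upto 0 $ n $ d = 1 $ n $ d"
    by (cases d) (auto simp: Phi_upto_def T_even_upto_def compositions_0 sum_compositions_Suc
        mtv_upto_Nil mtv_upto_0_Cons)
qed

text \<open>If the index \<open>N + 1\<close> occurs, it is paired with the first part
  \<open>j\<close> of the composition and contributes the \<open>j\<close>-th power of
  \<open>1 / (2 * N + 1) ^ 2\<close>.\<close>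

lemma T_even_upto_Suc_Suc:
  "T_even_upto (Suc N) n (Suc d) = T_even_upto N n (Suc d) +
     (\<Sum>j=1..n. (1 / (2 * real N + 1) ^ 2) ^ j * T_even_upto N (n - j) d)"
  by (simp add: T_even_upto_def sum_compositions_Suc mtv_upto_Suc_Cons sum.distrib
      sum_distrib_left power_mult power_one_over)

text \<open>Admitting the index \<open>N + 1\<close> multiplies the series by
  \<open>1 + v * G\<close> with \<open>G\<close> a geometric series in \<open>u\<close>. The
  denominator of \<open>G\<close> is cleared to avoid division.\<close>

lemma Phi_upto_Suc:
  fixes N :: nat
  defines "a \<equiv> fps_const (1 / (2 * real N + 1) ^ 2)"
  shows "Phi_upto (Suc N) * (1 - fps_const a * fps_X) =
           Phi_upto N * (1 - fps_const (a * (1 - fps_X)) * fps_X)"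
proof -
  define c where "c = 1 / (2 * real N + 1) ^ 2"
  define G where "G = Abs_fps (\<lambda>j. if j = 0 then 0 else fps_const (c ^ j))"
  \<comment> \<open>Here \<open>fps_const fps_X\<close> is \<open>v\<close>: using the new index
    raises the depth by one.\<close>
  have "Phi_upto (Suc N) = Phi_upto N + fps_const fps_X * (Phi_upto N * G)"
  proof (intro fps_ext)
    fix n d
    show "Phi_upto (Suc N) $ n $ d = (Phi_upto N + fps_const fps_X * (Phi_upto N * G)) $ n $ d"
    proof (cases d)
      case 0
      then show ?thesis
        by (auto simp: Phi_upto_def T_even_upto_def compositions_0 mtv_upto_Nil)
    next
      case (Suc e)
      have "(Phi_upto N * G) $ n = (\<Sum>j=0..n. G $ j * Phi_upto N $ (n - j))"
        by (subst mult.commute) (rule fps_mult_nth)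
      also have "\<dots> = (\<Sum>j=1..n. fps_const (c ^ j) * Phi_upto N $ (n - j))"
        by (rule sum.mono_neutral_cong_right) (auto simp: G_def)
      finally have "(Phi_upto N * G) $ n $ e = (\<Sum>j=1..n. c ^ j * T_even_upto N (n - j) e)"
        by (simp add: fps_sum_nth Phi_upto_def)
      then show ?thesis
        using T_even_upto_Suc_Suc [of N n e]
        by (simp add: Suc Phi_upto_def c_def)
    qed
  qed
  \<comment> \<open>The geometric series starts at \<open>j = 1\<close>, so
    \<open>G = c * u / (1 - c * u)\<close>.\<close>
  moreover have "G * (1 - fps_const (fps_const c) * fps_X) = fps_const (fps_const c) * fps_X"
  proof -
    have "G * (1 - fps_const (fps_const c) * fps_X) = G - fps_const (fps_const c) * (G * fps_X)"
      by (simp add: algebra_simps)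
    also have "\<dots> = fps_const (fps_const c) * fps_X"
    proof (rule fps_ext)
      fix n
      show "(G - fps_const (fps_const c) * (G * fps_X)) $ n = (fps_const (fps_const c) * fps_X) $ n"
        by (cases n) (auto simp: G_def)
    qed
    finally show ?thesis .
  qed
  ultimately have "Phi_upto (Suc N) * (1 - fps_const (fps_const c) * fps_X) =
      Phi_upto N * (1 - fps_const (fps_const c) * fps_X) +
      fps_const fps_X * Phi_upto N * (fps_const (fps_const c) * fps_X)"
    by (simp only: distrib_right mult.assoc)
  also have "\<dots> = Phi_upto N * (1 - fps_const (fps_const c * (1 - fps_X)) * fps_X)"
    by (simp add: algebra_simps flip: fps_const_mult fps_const_sub)
  finally show ?thesis
    by (simp add: a_def c_def)
qed

text \<open>The polynomial \<open>\<Prod>\<^bsub>n\<le>N\<^esub> (1 + a\<^sub>n w u)\<close> with \<open>a\<^sub>n = 1 / (2 n - 1)\<^sup>2\<close>.\<close>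

definition elem_sym_fps :: "nat \<Rightarrow> real fps \<Rightarrow> real fps fps" where
  "elem_sym_fps N w = Abs_fps (\<lambda>k. fps_const (mtv_upto N (replicate k 2)) * w ^ k)"

lemma elem_sym_fps_0: "elem_sym_fps 0 w = 1"
proof (rule fps_ext)
  fix k
  show "elem_sym_fps 0 w $ k = 1 $ k"
    by (cases k) (auto simp: elem_sym_fps_def mtv_upto_Nil mtv_upto_0_Cons)
qed

text \<open>The usual recursion of elementary symmetric polynomials: the new variable is either
  omitted or chosen once.\<close>

lemma elem_sym_fps_Suc:
  "elem_sym_fps (Suc N) w =
     elem_sym_fps N w * (1 + fps_const (fps_const (1 / (2 * real N + 1) ^ 2) * w) * fps_X)"
proof -
  define K where "K = fps_const (1 / (2 * real N + 1) ^ 2) * w"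
  have "elem_sym_fps (Suc N) w = elem_sym_fps N w + elem_sym_fps N w * fps_const K * fps_X"
  proof (rule fps_ext)
    fix k
    show "elem_sym_fps (Suc N) w $ k =
        (elem_sym_fps N w + elem_sym_fps N w * fps_const K * fps_X) $ k"
    proof (cases k)
      case 0
      then show ?thesis by (simp add: elem_sym_fps_def mtv_upto_Nil)
    next
      case (Suc l)
      have "fps_const (mtv_upto (Suc N) (replicate (Suc l) 2)) =
          fps_const (mtv_upto N (replicate (Suc l) 2)) +
          fps_const (mtv_upto N (replicate l 2)) * fps_const (1 / (2 * real N + 1) ^ 2)"
        by (simp add: mtv_upto_Suc_Cons)
      moreover have "elem_sym_fps M w $ k = fps_const (mtv_upto M (replicate (Suc l) 2)) * w ^ Suc l" for M
        by (simp only: elem_sym_fps_def fps_nth_Abs_fps Suc)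
      moreover have "(elem_sym_fps N w * fps_const K * fps_X) $ k =
          fps_const (mtv_upto N (replicate l 2)) * w ^ l * K"
        by (simp add: elem_sym_fps_def Suc)
      ultimately show ?thesis
        by (simp only: fps_add_nth K_def ring_distribs power_Suc mult_ac)
    qed
  qed
  then show ?thesis
    by (simp only: K_def distrib_left mult_1_right mult.assoc)
qed

text \<open>The finite product formula with denominators cleared: \<open>w = - 1\<close> gives the
  denominators and \<open>w = v - 1\<close> the numerators.\<close>

lemma Phi_upto_mult: "Phi_upto N * elem_sym_fps N (- 1) = elem_sym_fps N (fps_X - 1)"
proof (induction N)
  case 0
  then show ?case by (simp add: Phi_upto_0 elem_sym_fps_0)
next
  case (Suc N)
  let ?a = "fps_const (1 / (2 * real N + 1) ^ 2)"
  have "Phi_upto (Suc N) * elem_sym_fps (Suc N) (- 1) =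
      elem_sym_fps N (- 1) * (Phi_upto (Suc N) * (1 - fps_const ?a * fps_X))"
    by (simp add: elem_sym_fps_Suc mult_ac)
  also have "\<dots> = elem_sym_fps N (- 1) * (Phi_upto N * (1 - fps_const (?a * (1 - fps_X)) * fps_X))"
    by (simp only: Phi_upto_Suc)
  also have "\<dots> = Phi_upto N * elem_sym_fps N (- 1) * (1 - fps_const (?a * (1 - fps_X)) * fps_X)"
    by (simp only: mult_ac)
  also have "1 - fps_const (?a * (1 - fps_X)) * fps_X = 1 + fps_const (?a * (fps_X - 1)) * fps_X"
    by (simp add: algebra_simps flip: fps_const_mult fps_const_sub)
  finally show ?case
    by (simp only: Suc elem_sym_fps_Suc)
qed

section \<open>Passage to the limit in the coefficients\<close>

lemma elem_sym_fps_tendsto: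
  "(\<lambda>N. elem_sym_fps N w $ k $ d) \<longlonglongrightarrow> cos_coeff_half k * ((- w) ^ k $ d)"
proof -
  have "(\<lambda>N. mtv_upto N (replicate k 2) * (w ^ k $ d)) \<longlonglongrightarrow> mtv (replicate k 2) * (w ^ k $ d)"
    by (intro tendsto_mult_right mtv_upto_tendsto) auto
  moreover have "mtv (replicate k 2) * (w ^ k $ d) = cos_coeff_half k * ((- w) ^ k $ d)"
    by (cases "even k") (auto simp flip: mtv_replicate_2)
  ultimately show ?thesis
    by (simp add: elem_sym_fps_def)
qed

text \<open>Each coefficient of a product is a finite sum, so the finite identity passes to the
  limit coefficientwise, and limits are unique.\<close>

lemma Phi_mult_cos:
  "Phi * Abs_fps (\<lambda>k. fps_const (cos_coeff_half k)) = cos_series"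
proof (intro fps_ext)
  fix n d
  have "(\<lambda>N. \<Sum>i=0..n. \<Sum>j=0..d. T_even_upto N i j * (elem_sym_fps N (- 1) $ (n - i) $ (d - j)))
      \<longlonglongrightarrow> (\<Sum>i=0..n. \<Sum>j=0..d. T_even i j * (cos_coeff_half (n - i) * ((- (- 1)) ^ (n - i) $ (d - j))))"
    by (intro tendsto_sum tendsto_mult T_even_upto_tendsto elem_sym_fps_tendsto)
  also have "(\<Sum>i=0..n. \<Sum>j=0..d. T_even i j * (cos_coeff_half (n - i) * ((- (- 1)) ^ (n - i) $ (d - j)))) =
      (Phi * Abs_fps (\<lambda>k. fps_const (cos_coeff_half k))) $ n $ d"
    unfolding fps_mult_nth fps_sum_nth Phi_nth_nth fps_nth_Abs_fps minus_minus power_one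
    by (intro sum.cong refl) simp
  also have "(\<lambda>N. \<Sum>i=0..n. \<Sum>j=0..d. T_even_upto N i j * (elem_sym_fps N (- 1) $ (n - i) $ (d - j))) =
      (\<lambda>N. (Phi_upto N * elem_sym_fps N (- 1)) $ n $ d)"
    by (simp add: fps_mult_nth fps_sum_nth Phi_upto_def)
  also have "\<dots> = (\<lambda>N. elem_sym_fps N (fps_X - 1) $ n $ d)"
    by (simp only: Phi_upto_mult)
  finally have "(\<lambda>N. elem_sym_fps N (fps_X - 1) $ n $ d) \<longlonglongrightarrow>
      (Phi * Abs_fps (\<lambda>k. fps_const (cos_coeff_half k))) $ n $ d" .
  moreover have "(\<lambda>N. elem_sym_fps N (fps_X - 1) $ n $ d) \<longlonglongrightarrow> cos_series $ n $ d"
    using elem_sym_fps_tendsto [of "fps_X - 1" n d] by (simp add: cos_series_def)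
  ultimately show "(Phi * Abs_fps (\<lambda>k. fps_const (cos_coeff_half k))) $ n $ d = cos_series $ n $ d"
    by (rule LIMSEQ_unique)
qed

text \<open>Embedding series in \<open>u\<close> alone by \<open>fps_const\<close> on coefficients
  respects products, so the reciprocal relation is inherited.\<close>

lemma cos_mult_sec_series: "Abs_fps (\<lambda>k. fps_const (cos_coeff_half k)) * sec_series = 1"
proof (rule fps_ext)
  fix n
  have "(Abs_fps (\<lambda>k. fps_const (cos_coeff_half k)) * sec_series) $ n =
      (\<Sum>i=0..n. fps_const (cos_coeff_half i * sec_series_u $ (n - i)))"
    by (simp add: fps_mult_nth sec_series_def)
  also have "\<dots> = fps_const ((Abs_fps cos_coeff_half * sec_series_u) $ n)"
    by (rule fps_ext) (simp add: fps_mult_nth fps_sum_nth)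
  also have "\<dots> = 1 $ n"
    by (simp add: cos_times_sec_series_u)
  finally show "(Abs_fps (\<lambda>k. fps_const (cos_coeff_half k)) * sec_series) $ n = 1 $ n" .
qed

theorem theorem1p2:
  shows "Phi = cos_series * sec_series"
  by (metis Phi_mult_cos cos_mult_sec_series mult.assoc mult.right_neutral)

end
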